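(* Let $A,B\in\mathcal{M}_n$ be positive definite matrices and $X\in\mathcal{M}_n$. Then for any real numbers $\alpha\neq\beta$ and any unitarily invariant norm $|||\cdot|||$ on matrices, $$\left|\left|\left|A^{\frac{\alpha+\beta}{2}}XB^{1-\frac{\alpha+\beta}{2}}+A^{1-\frac{\alpha+\beta}{2}}XB^{\frac{\alpha+\beta}{2}}\right|\right|\right|\le\frac{1}{|\beta-\alpha|}\left|\left|\left|\int_{\alpha}^{\beta}\left(A^{\nu}XB^{1-\nu}+A^{1-\nu}XB^{\nu}\right)d\nu\right|\right|\right|$$ $$\le\frac12\left|\left|\left|A^{\alpha}XB^{1-\alpha}+A^{1-\alpha}XB^{\alpha}+A^{\beta}XB^{1-\beta}+A^{1-\beta}XB^{\beta}\right|\right|\right|.$$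
   Context: $\mathcal{M}_n$ is the algebra of $n\times n$ complex matrices. A unitarily invariant norm satisfies $|||UTV|||=|||T|||$ for all unitary $U,V$. *)

theory Defs
  imports "HOL-Analysis.Analysis"
begin

definition cadjoint :: "complex^'n^'m \<Rightarrow> complex^'m^'n" where
  "cadjoint A = (\<chi> i j. cnj (A $ j $ i))"

definition unitary :: "complex^'n^'n \<Rightarrow> bool" where
  "unitary U \<longleftrightarrow> cadjoint U ** U = mat 1 \<and> U ** cadjoint U = mat 1"

definition cinner :: "complex^'n \<Rightarrow> complex^'n \<Rightarrow> complex" where
  "cinner x y = (\<Sum>i\<in>UNIV. cnj (x $ i) * y $ i)"

text \<open>For a Hermitian matrix the value of the quadratic form is real, so taking \<open>Re\<close> loses nothing.\<close>

definition pos_def :: "complex^'n^'n \<Rightarrow> bool" where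
  "pos_def A \<longleftrightarrow> cadjoint A = A \<and> (\<forall>x. x \<noteq> 0 \<longrightarrow> 0 < Re (cinner x (A *v x)))"

definition diag_of :: "('n \<Rightarrow> real) \<Rightarrow> complex^'n^'n" where
  "diag_of d = (\<chi> i j. if i = j then of_real (d i) else 0)"

text \<open>Real powers of a positive definite matrix by functional calculus: if \<open>A = U diag(d) U*\<close> with
  \<open>U\<close> unitary and \<open>d > 0\<close>, then \<open>A\<close> to the power \<open>r\<close> is \<open>U diag(d powr r) U*\<close>. A diagonalization
  exists by the spectral theorem (not proved here), and the result does not depend on its choice
  (\<open>mpowr_eqI\<close> below). Matrices that are not positive definite get an unspecified value.\<close>

definition mpowr :: "complex^'n^'n \<Rightarrow> real \<Rightarrow> complex^'n^'n" where
  "mpowr A r = (THE P. \<exists>U d. unitary U \<and> (\<forall>i. 0 < d i) \<and>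
      A = U ** diag_of d ** cadjoint U \<and>
      P = U ** diag_of (\<lambda>i. d i powr r) ** cadjoint U)"

lemma diag_of_mult_nth: "(diag_of d ** W) $ i $ j = of_real (d i) * W $ i $ j"
  by (simp add: diag_of_def matrix_matrix_mult_def if_distrib[of "\<lambda>x. x * _"] cong: if_cong)

lemma mult_diag_of_nth: "(W ** diag_of d) $ i $ j = W $ i $ j * of_real (d j)"
  by (simp add: diag_of_def matrix_matrix_mult_def if_distrib[of "\<lambda>x. _ * x"] cong: if_cong)

lemma diagonalization_powr_unique:
  assumes U: "unitary U" and V: "unitary V"
    and eq: "U ** diag_of d ** cadjoint U = V ** diag_of e ** cadjoint V"
  shows "U ** diag_of (\<lambda>i. d i powr r) ** cadjoint U = V ** diag_of (\<lambda>i. e i powr r) ** cadjoint V"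
proof -
  define W where "W = cadjoint V ** U"
  have UU: "cadjoint U ** U = mat 1" "U ** cadjoint U = mat 1"
    and VV: "cadjoint V ** V = mat 1" "V ** cadjoint V = mat 1"
    using U V by (auto simp: unitary_def)
  have "W ** diag_of d = cadjoint V ** (U ** diag_of d ** cadjoint U) ** U"
    by (simp add: W_def matrix_mul_assoc[symmetric] UU)
  also have "\<dots> = (cadjoint V ** V) ** diag_of e ** cadjoint V ** U"
    by (simp add: eq matrix_mul_assoc)
  also have "\<dots> = diag_of e ** W"
    by (simp add: W_def VV matrix_mul_assoc)
  finally have *: "W ** diag_of d = diag_of e ** W" .
  have "W ** diag_of (\<lambda>i. d i powr r) = diag_of (\<lambda>i. e i powr r) ** W"
  proof -
    have "W $ i $ j * of_real (d j powr r) = of_real (e i powr r) * W $ i $ j" for i j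
    proof (cases "W $ i $ j = 0")
      case False
      have "W $ i $ j * of_real (d j) = of_real (e i) * W $ i $ j"
        using arg_cong[OF *, of "\<lambda>M. M $ i $ j"] by (simp add: diag_of_mult_nth mult_diag_of_nth)
      then have "d j = e i"
        using False by (simp add: mult.commute)
      then show ?thesis by simp
    qed simp
    then show ?thesis
      by (simp add: vec_eq_iff diag_of_mult_nth mult_diag_of_nth)
  qed
  then have "V ** (W ** diag_of (\<lambda>i. d i powr r)) ** cadjoint U
      = V ** (diag_of (\<lambda>i. e i powr r) ** W) ** cadjoint U"
    by simp
  moreover have "V ** (W ** diag_of (\<lambda>i. d i powr r)) ** cadjoint U
      = (V ** cadjoint V) ** U ** diag_of (\<lambda>i. d i powr r) ** cadjoint U"
    by (simp add: W_def matrix_mul_assoc)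
  moreover have "V ** (diag_of (\<lambda>i. e i powr r) ** W) ** cadjoint U
      = V ** diag_of (\<lambda>i. e i powr r) ** cadjoint V ** (U ** cadjoint U)"
    by (simp add: W_def matrix_mul_assoc)
  ultimately show ?thesis
    by (simp add: UU VV)
qed

lemma mpowr_eqI:
  assumes "unitary U" "\<And>i. 0 < d i" "A = U ** diag_of d ** cadjoint U"
  shows "mpowr A r = U ** diag_of (\<lambda>i. d i powr r) ** cadjoint U"
  unfolding mpowr_def
proof (rule the_equality)
  fix P
  assume "\<exists>V e. unitary V \<and> (\<forall>i. 0 < e i) \<and> A = V ** diag_of e ** cadjoint V \<and>
      P = V ** diag_of (\<lambda>i. e i powr r) ** cadjoint V"
  then show "P = U ** diag_of (\<lambda>i. d i powr r) ** cadjoint U"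
    using diagonalization_powr_unique[OF assms(1)] assms(3) by metis
qed (use assms in blast)

definition is_cnorm :: "(complex^'n^'n \<Rightarrow> real) \<Rightarrow> bool" where
  "is_cnorm N \<longleftrightarrow>
     (\<forall>T. 0 \<le> N T) \<and>
     (\<forall>T. N T = 0 \<longleftrightarrow> T = 0) \<and>
     (\<forall>c T. N (\<chi> i j. c * T $ i $ j) = cmod c * N T) \<and>
     (\<forall>S T. N (S + T) \<le> N S + N T)"

definition unitarily_invariant_norm :: "(complex^'n^'n \<Rightarrow> real) \<Rightarrow> bool" where
  "unitarily_invariant_norm N \<longleftrightarrow>
     is_cnorm N \<and> (\<forall>U V T. unitary U \<longrightarrow> unitary V \<longrightarrow> N (U ** T ** V) = N T)"

end

theory Submission
  imports Defs "HOL-Real_Asymp.Real_Asymp"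
begin

text \<open>
  Diagonalise \<open>A = U diag(a) U*\<close>, \<open>B = V diag(b) V*\<close> and put \<open>t = ln a\<^sub>i - ln b\<^sub>j\<close>. In these bases
  \<open>A\<^sup>\<nu> X B\<^sup>1\<^sup>-\<^sup>\<nu> + A\<^sup>1\<^sup>-\<^sup>\<nu> X B\<^sup>\<nu>\<close> is a fixed matrix Schur-multiplied by \<open>cosh ((\<nu> - 1/2) t)\<close>. With
  \<open>m = (\<alpha> + \<beta> - 1)/2\<close> and \<open>c = (\<beta> - \<alpha>)/2\<close>, the midpoint, the mean over \<open>[\<alpha>, \<beta>]\<close> and the mean of the
  endpoint values carry the multipliers \<open>cosh (m t)\<close>, \<open>cosh (m t) sinh (c t) / (c t)\<close> and
  \<open>cosh (m t) cosh (c t)\<close>. So it suffices that \<open>t / sinh t\<close> and \<open>tanh t / t\<close> are contractive Schur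
  multipliers in \<open>t = x\<^sub>i - y\<^sub>j\<close>.

  The multiplier \<open>cos\<close> is contractive, being an average of two diagonal unitary conjugations, and
  a resolvent estimate gives \<open>1 / (1 + c\<^sup>2 t\<^sup>2)\<close>. Euler's product for \<open>sinh\<close> then yields \<open>t / sinh t\<close>,
  and, since \<open>(1 + u) / (1 + l\<^sup>2 u)\<close> is a convex combination of \<open>1\<close> and \<open>1 / (1 + l\<^sup>2 u)\<close> for \<open>l \<ge> 1\<close>,
  also \<open>l sinh t / sinh (l t)\<close>. Letting \<open>l\<close> tend to \<open>1\<close>, the generator of the latter family is
  \<open>1 - t coth t\<close>, and the same resolvent estimate gives \<open>1 / (t coth t) = tanh t / t\<close>.
\<close>

section \<open>Limits and hyperbolic identities\<close>

text \<open>Since \<open>1 - cos h\<close> behaves like \<open>h\<^sup>2 / 2\<close> near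
  \<open>0\<close>, the squared variable appears as a limit of multiples of \<open>1 - cos\<close>,
  the form that \<open>expansive_resolvent\<close> consumes.\<close>

lemma cos_resolvent_limit:
  fixes x c :: real
  shows "(\<lambda>n. 1 + (2 * c\<^sup>2 * (real n)\<^sup>2) * (1 - cos (x / real n))) \<longlonglongrightarrow> 1 + c\<^sup>2 * x\<^sup>2"
proof -
  consider "x = 0 \<or> c = 0" | "x > 0" | "x < 0" by fastforce
  then show ?thesis
  proof cases
    case 1 then show ?thesis by auto
  next
    case 2 then show ?thesis unfolding power2_eq_square[of x] by real_asymp
  next
    case 3 then show ?thesis unfolding power2_eq_square[of x] by real_asymp
  qed
qed

text \<open>The value at \<open>0\<close> is the continuous extension, so that coinciding logarithms
  of eigenvalues need no separate treatment later.\<close>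

definition sinhc :: "real \<Rightarrow> real" where
  "sinhc u = (if u = 0 then 1 else sinh u / u)"

lemma sinhc_pos: "0 < sinhc u"
  by (auto simp: sinhc_def zero_less_divide_iff)

lemma mult_sinhc: "u * sinhc u = sinh u"
  by (simp add: sinhc_def)

text \<open>Euler's product for the sine at the imaginary point \<open>z = \<i> * u / pi\<close>,
  where \<open>- z^2\<close> becomes \<open>(u / pi)\<^sup>2\<close>.\<close>

lemma sinhc_product: "(\<lambda>n. \<Prod>k=1..n. 1 + (u / (pi * real k))\<^sup>2) \<longlonglongrightarrow> sinhc u"
proof (cases "u = 0")
  case False
  define z where "z = \<i> * of_real (u / pi)"
  have z: "of_real pi * z = \<i> * of_real u"
    by (simp add: z_def)
  have "(\<lambda>n. of_real pi * z * (\<Prod>k=1..n. 1 - z^2 / of_nat k^2)) \<longlonglongrightarrow> sin (of_real pi * z)"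
    by (rule sin_product_formula_complex)
  then have "(\<lambda>n. \<i> * of_real u * (\<Prod>k=1..n. 1 - z^2 / of_nat k^2)) \<longlonglongrightarrow> sin (\<i> * of_real u)"
    by (simp only: z)
  moreover have "1 - z^2 / of_nat k^2 = of_real (1 + (u / (pi * real k))\<^sup>2)" for k
    by (simp add: z_def power_mult_distrib power_divide)
  moreover have "sin (\<i> * of_real u) = \<i> * of_real (sinh u)"
    by (simp add: sin_i_times sinh_field_def exp_of_real[symmetric] exp_minus)
  ultimately have "(\<lambda>n. \<i> * of_real u * of_real (\<Prod>k=1..n. 1 + (u / (pi * real k))\<^sup>2))
      \<longlonglongrightarrow> \<i> * of_real (sinh u)"
    by (simp only: of_real_prod)
  then have "(\<lambda>n. \<i> * of_real u * of_real (\<Prod>k=1..n. 1 + (u / (pi * real k))\<^sup>2) / (\<i> * of_real u))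
      \<longlonglongrightarrow> \<i> * of_real (sinh u) / (\<i> * of_real u)"
    using False by (intro tendsto_divide tendsto_const) auto
  moreover have "\<i> * of_real u * of_real c / (\<i> * of_real u) = (of_real c :: complex)" for c
    using False by simp
  moreover have "\<i> * of_real (sinh u) / (\<i> * of_real u) = (of_real (sinhc u) :: complex)"
    using False by (simp add: sinhc_def)
  ultimately have "(\<lambda>n. of_real (\<Prod>k=1..n. 1 + (u / (pi * real k))\<^sup>2) :: complex) \<longlonglongrightarrow> of_real (sinhc u)"
    by (simp only:)
  then show ?thesis by (simp only: tendsto_of_real_iff)
qed (simp add: sinhc_def)

text \<open>With \<open>h = 1 / n\<close> the quotient is \<open>f h\<close>, where
  \<open>f 0 = 1\<close>; the limit is therefore one minus the derivative of \<open>f\<close> at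
  \<open>0\<close>, that is, \<open>u coth u\<close> away from \<open>u = 0\<close>.\<close>

lemma sinhc_ratio_limit:
  "(\<lambda>n. 1 + real n * (1 - sinhc u / sinhc ((1 + 1 / real n) * u))) \<longlonglongrightarrow> cosh u / sinhc u"
proof (cases "u = 0")
  case False
  define f where "f h = (1 + h) * sinh u / sinh ((1 + h) * u)" for h
  have f0: "f 0 = 1" using False by (simp add: f_def)
  have "(f has_real_derivative (1 - cosh u / sinhc u)) (at 0)"
    unfolding f_def using False
    by (auto intro!: derivative_eq_intros simp: sinhc_def power2_eq_square divide_simps)
       (simp add: algebra_simps)
  then have "((\<lambda>h. (f h - 1) / h) \<longlongrightarrow> 1 - cosh u / sinhc u) (at 0)"
    by (simp add: DERIV_def f0)
  moreover have "filterlim (\<lambda>n. 1 / real n) (at 0) sequentially" by real_asymp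
  ultimately have "(\<lambda>n. (f (1 / real n) - 1) / (1 / real n)) \<longlonglongrightarrow> 1 - cosh u / sinhc u"
    by (rule filterlim_compose)
  from tendsto_diff[OF tendsto_const[of 1] this]
  have "(\<lambda>n. 1 + real n * (1 - f (1 / real n))) \<longlonglongrightarrow> cosh u / sinhc u"
    by (simp add: algebra_simps)
  moreover have "eventually (\<lambda>n. 1 + real n * (1 - f (1 / real n)) =
      1 + real n * (1 - sinhc u / sinhc ((1 + 1 / real n) * u))) sequentially"
    using eventually_gt_at_top[of 0]
  proof eventually_elim
    case (elim n)
    then have "1 + 1 / real n > 0" by (simp add: add_pos_pos)
    then show ?case using False by (simp add: f_def sinhc_def)
  qed
  ultimately show ?thesis
    by (rule Lim_transform_eventually)
qed (simp add: sinhc_def)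

text \<open>The antiderivative \<open>sinh ((s - a) * t) / t\<close>, written so that it remains
  correct at \<open>t = 0\<close>.\<close>

lemma real_derivative_mult_sinhc:
  "((\<lambda>s. (s - a) * sinhc ((s - a) * t)) has_real_derivative cosh ((s - a) * t)) (at s within S)"
proof -
  have "(\<lambda>s. (s - a) * sinhc ((s - a) * t)) = (\<lambda>s. if t = 0 then s - a else sinh ((s - a) * t) / t)"
    by (auto simp: sinhc_def fun_eq_iff)
  then show ?thesis
    by (cases "t = 0") (auto intro!: derivative_eq_intros)
qed

text \<open>The formula \<open>sinh (P + Q) - sinh (P - Q) = 2 sinh Q cosh P\<close>, divided by
  \<open>t\<close>. It turns the increment of the antiderivative into length times mean
  value.\<close>

lemma mult_sinhc_diff:
  "p * sinhc (p * t) - q * sinhc (q * t) = (p - q) * (sinhc ((p - q) / 2 * t) * cosh ((p + q) / 2 * t))"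
proof (cases "t = 0 \<or> p = q")
  case False
  define P where "P = (p + q) / 2 * t"
  define Q where "Q = (p - q) / 2 * t"
  have pq: "p * t = P + Q" "q * t = P - Q"
    by (auto simp: P_def Q_def field_simps)
  have "t * (p * sinhc (p * t) - q * sinhc (q * t)) = sinh (P + Q) - sinh (P - Q)"
    using mult_sinhc[of "p * t"] mult_sinhc[of "q * t"] unfolding pq[symmetric] by (simp add: algebra_simps)
  also have "\<dots> = 2 * sinh Q * cosh P"
    by (simp add: sinh_add sinh_diff)
  also have "\<dots> = t * ((p - q) * (sinhc Q * cosh P))"
    unfolding mult_sinhc[of Q, symmetric] by (simp add: Q_def)
  finally show ?thesis
    using False by (simp add: P_def Q_def)
qed (auto simp: sinhc_def)

lemma cosh_add_cosh:
  fixes p q t :: real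
  shows "cosh (p * t) + cosh (q * t) = 2 * (cosh ((p - q) / 2 * t) * cosh ((p + q) / 2 * t))"
proof -
  define P where "P = (p + q) / 2 * t"
  define Q where "Q = (p - q) / 2 * t"
  have pq: "p * t = P + Q" "q * t = P - Q"
    by (auto simp: P_def Q_def field_simps)
  show ?thesis
    unfolding pq P_def[symmetric] Q_def[symmetric] by (simp add: cosh_add cosh_diff)
qed

text \<open>Factoring out the geometric mean \<open>exp ((x + y) / 2)\<close> of the eigenvalues
  confines the dependence on \<open>\<nu>\<close> to a function of \<open>x - y\<close>.\<close>

lemma heinz_mean_eq_cosh:
  fixes x y \<nu> :: real
  shows "exp (\<nu> * x) * exp ((1 - \<nu>) * y) + exp ((1 - \<nu>) * x) * exp (\<nu> * y)
    = cosh ((\<nu> - 1 / 2) * (x - y)) * (2 * exp ((x + y) / 2))"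
proof -
  have "exp (\<nu> * x) * exp ((1 - \<nu>) * y) = exp ((\<nu> - 1 / 2) * (x - y)) * exp ((x + y) / 2)"
    "exp ((1 - \<nu>) * x) * exp (\<nu> * y) = exp (- ((\<nu> - 1 / 2) * (x - y))) * exp ((x + y) / 2)"
    by (simp_all add: exp_add[symmetric] field_simps)
  then show ?thesis by (simp add: cosh_field_def algebra_simps)
qed

section \<open>Contractive Schur multipliers\<close>

definition schur :: "(real \<Rightarrow> real) \<Rightarrow> ('n \<Rightarrow> real) \<Rightarrow> ('n \<Rightarrow> real) \<Rightarrow> complex^'n^'n \<Rightarrow> complex^'n^'n" where
  "schur f x y Z = (\<chi> i j. of_real (f (x i - y j)) * Z $ i $ j)"

text \<open>Expansion in matrix units: scalar functions times constant matrices, to which the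
  derivative rules apply directly.\<close>

lemma schur_sum_axis:
  "schur f x y Z = (\<Sum>i\<in>UNIV. \<Sum>j\<in>UNIV. f (x i - y j) *\<^sub>R axis i (axis j (Z $ i $ j)))"
proof -
  have "f (x i - y j) *\<^sub>R axis i (axis j (Z $ i $ j)) $ k $ l
      = (if i = k then if j = l then f (x k - y l) *\<^sub>R Z $ k $ l else 0 else 0)" for i j k l
    by (simp add: axis_def)
  then have "(\<Sum>i\<in>UNIV. \<Sum>j\<in>UNIV. f (x i - y j) *\<^sub>R axis i (axis j (Z $ i $ j))) $ k $ l
      = (\<Sum>i\<in>UNIV. if i = k then \<Sum>j\<in>UNIV. if j = l then f (x k - y l) *\<^sub>R Z $ k $ l else 0 else 0)"
    for k l
    by (simp only: sum_component vector_scaleR_component) (intro sum.cong refl, simp)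
  then show ?thesis
    by (simp add: vec_eq_iff schur_def scaleR_conv_of_real[where 'a=complex])
qed

lemma has_vector_derivative_schur:
  assumes "\<And>t. ((\<lambda>s. f s t) has_real_derivative f' t) (at s within S)"
  shows "((\<lambda>s. schur (f s) x y Z) has_vector_derivative schur f' x y Z) (at s within S)"
  unfolding schur_sum_axis
  by (auto intro!: derivative_eq_intros assms)

lemma schur_schur: "schur f x y (schur g x y Z) = schur (\<lambda>t. f t * g t) x y Z"
  by (simp add: schur_def mult.assoc)

lemma schur_const: "schur (\<lambda>t. c) x y Z = c *\<^sub>R Z"
  by (simp add: schur_def vec_eq_iff scaleR_conv_of_real[where 'a=complex])

lemma schur_add: "schur (\<lambda>t. f t + g t) x y Z = schur f x y Z + schur g x y Z"
  by (simp add: schur_def vec_eq_iff algebra_simps)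

lemma schur_cmult: "schur (\<lambda>t. c * f t) x y Z = c *\<^sub>R schur f x y Z"
  by (simp add: schur_def vec_eq_iff scaleR_conv_of_real[where 'a=complex])

lemma schur_dilate: "schur (\<lambda>t. f (c * t)) x y Z = schur f (\<lambda>i. c * x i) (\<lambda>j. c * y j) Z"
  by (simp add: schur_def right_diff_distrib)

lemma tendsto_schur:
  assumes "\<And>t. (\<lambda>n. f n t) \<longlonglongrightarrow> g t"
  shows "(\<lambda>n. schur (f n) x y Z) \<longlonglongrightarrow> schur g x y Z"
  unfolding schur_def by (intro vec_tendstoI) (auto intro!: tendsto_intros assms)

text \<open>Quantifying over all nodes \<open>x\<close>, \<open>y\<close> makes the notion stable
  under rescaling the argument of \<open>f\<close>.\<close>

definition contractive_multiplier :: "(complex^'n^'n \<Rightarrow> real) \<Rightarrow> (real \<Rightarrow> real) \<Rightarrow> bool" where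
  "contractive_multiplier N f \<longleftrightarrow> (\<forall>x y Z. N (schur f x y Z) \<le> N Z)"

context
  fixes N :: "complex^'n^'n \<Rightarrow> real"
  assumes N: "unitarily_invariant_norm N"
begin

lemma norm_triangle: "N (S + T) \<le> N S + N T"
  using N by (simp add: unitarily_invariant_norm_def is_cnorm_def)

lemma norm_scaleR: "N (c *\<^sub>R T) = \<bar>c\<bar> * N T"
proof -
  have "N (\<chi> i j. of_real c * T $ i $ j) = cmod (of_real c) * N T"
    using N unfolding unitarily_invariant_norm_def is_cnorm_def by blast
  moreover have "(\<chi> i j. of_real c * T $ i $ j) = c *\<^sub>R T"
    by (simp add: vec_eq_iff scaleR_conv_of_real[where 'a=complex])
  ultimately show ?thesis by simp
qed

lemma norm_unitary: "unitary U \<Longrightarrow> unitary V \<Longrightarrow> N (U ** T ** V) = N T"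
  using N by (simp add: unitarily_invariant_norm_def)

text \<open>\<open>N\<close> is given only by algebraic axioms; it is convex, and a convex function
  on a finite-dimensional space is continuous.\<close>

lemma tendsto_uinorm:
  assumes "f \<longlonglongrightarrow> T"
  shows "(\<lambda>n. N (f n)) \<longlonglongrightarrow> N T"
proof -
  have "convex_on UNIV N"
  proof (rule convex_onI)
    fix t :: real and S T assume "0 < t" "t < 1"
    then show "N ((1 - t) *\<^sub>R S + t *\<^sub>R T) \<le> (1 - t) * N S + t * N T"
      using norm_triangle[of "(1 - t) *\<^sub>R S" "t *\<^sub>R T"] by (simp add: norm_scaleR)
  qed simp
  then have "continuous_on UNIV N"
    by (rule convex_on_continuous[OF open_UNIV])
  then show ?thesis
    by (rule continuous_on_tendsto_compose[OF _ assms]) auto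
qed

section \<open>Closure properties of contractive multipliers\<close>

lemma contractive_const1: "contractive_multiplier N (\<lambda>t. 1)"
  by (simp add: contractive_multiplier_def schur_const)

lemma contractive_mult:
  assumes "contractive_multiplier N f" "contractive_multiplier N g"
  shows "contractive_multiplier N (\<lambda>t. f t * g t)"
  using assms unfolding contractive_multiplier_def schur_schur[symmetric] by (meson order.trans)

lemma contractive_prod:
  assumes "\<And>k. k \<in> K \<Longrightarrow> contractive_multiplier N (f k)"
  shows "contractive_multiplier N (\<lambda>t. \<Prod>k\<in>K. f k t)"
  using assms by (induction K rule: infinite_finite_induct) (auto intro: contractive_const1 contractive_mult)

lemma contractive_convex:
  assumes "contractive_multiplier N f" "contractive_multiplier N g" "0 \<le> a" "0 \<le> b" "a + b = 1"
  shows "contractive_multiplier N (\<lambda>t. a * f t + b * g t)"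
  unfolding contractive_multiplier_def
proof (intro allI)
  fix x y Z
  have "N (schur (\<lambda>t. a * f t + b * g t) x y Z) \<le> a * N (schur f x y Z) + b * N (schur g x y Z)"
    using norm_triangle[of "a *\<^sub>R schur f x y Z" "b *\<^sub>R schur g x y Z"] assms
    by (simp add: schur_add schur_cmult norm_scaleR)
  also have "\<dots> \<le> a * N Z + b * N Z"
    using assms by (intro add_mono mult_left_mono) (auto simp: contractive_multiplier_def)
  finally show "N (schur (\<lambda>t. a * f t + b * g t) x y Z) \<le> N Z"
    using assms by (simp add: distrib_right[symmetric])
qed

lemma contractive_dilate:
  "contractive_multiplier N f \<Longrightarrow> contractive_multiplier N (\<lambda>t. f (c * t))"
  by (simp add: contractive_multiplier_def schur_dilate)

text \<open>Pointwise convergence suffices because only the finitely many values at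
  \<open>x i - y j\<close> enter.\<close>

lemma contractive_limit:
  assumes "\<And>n. contractive_multiplier N (f n)" "\<And>t. (\<lambda>n. f n t) \<longlonglongrightarrow> g t"
  shows "contractive_multiplier N g"
  unfolding contractive_multiplier_def
proof (intro allI)
  fix x y Z
  have "(\<lambda>n. N (schur (f n) x y Z)) \<longlonglongrightarrow> N (schur g x y Z)"
    by (intro tendsto_uinorm tendsto_schur assms)
  then show "N (schur g x y Z) \<le> N Z"
    by (rule LIMSEQ_le_const2) (use assms in \<open>auto simp: contractive_multiplier_def\<close>)
qed

section \<open>Contractive multipliers from unitaries, resolvents and products\<close>

lemma unitary_diag_cis: "unitary (\<chi> i j. if i = j then cis (x i) else 0)"
  by (simp add: unitary_def cadjoint_def matrix_matrix_mult_def mat_def vec_eq_iff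
      if_distrib[of "\<lambda>z. z * _"] if_distrib[of cnj] cis_cnj cis_mult cong: if_cong)

lemma contractive_cos: "contractive_multiplier N cos"
  unfolding contractive_multiplier_def
proof (intro allI)
  fix x y :: "'n \<Rightarrow> real" and Z
  let ?D = "\<lambda>x. (\<chi> i j. if i = j then cis (x i) else 0) :: complex^'n^'n"
  have entry: "(?D x ** Z ** ?D y) $ i $ j = cis (x i + y j) * Z $ i $ j" for x y i j
    by (simp add: matrix_matrix_mult_def if_distrib[of "\<lambda>z. z * _"] if_distrib[of "\<lambda>z. _ * z"]
        cis_mult[symmetric] mult_ac cong: if_cong)
  have N_eq: "N (?D x ** Z ** ?D y) = N Z" for x y
    by (intro norm_unitary unitary_diag_cis)
  have cos: "cis t + cis (- t) = 2 * of_real (cos t)" for t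
    by (simp add: complex_eq_iff)
  have "schur cos x y Z = (1 / 2) *\<^sub>R (?D x ** Z ** ?D (\<lambda>j. - y j))
      + (1 / 2) *\<^sub>R (?D (\<lambda>i. - x i) ** Z ** ?D y)"
  proof -
    have "schur cos x y Z $ i $ j = (1 / 2) *\<^sub>R (?D x ** Z ** ?D (\<lambda>j. - y j)) $ i $ j
      + (1 / 2) *\<^sub>R (?D (\<lambda>i. - x i) ** Z ** ?D y) $ i $ j" for i j
    proof -
      have "of_real (cos (x i - y j)) * Z $ i $ j =
          (1 / 2) * ((cis (x i - y j) + cis (- (x i - y j))) * Z $ i $ j)"
        by (simp only: cos) simp
      then show ?thesis
        unfolding entry by (simp add: schur_def scaleR_conv_of_real[where 'a=complex] algebra_simps)
    qed
    then show ?thesis by (simp add: vec_eq_iff)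
  qed
  also have "N \<dots> \<le> (1 / 2) * N Z + (1 / 2) * N Z"
    by (rule order.trans[OF norm_triangle]) (simp add: norm_scaleR N_eq)
  finally show "N (schur cos x y Z) \<le> N Z" by simp
qed

text \<open>This is the Hille--Yosida estimate: when all \<open>p n\<close> are contractive, \<open>g - 1\<close> is a limit of
  dissipative generators \<open>r n * (1 - p n)\<close>, so its resolvent \<open>1 / g\<close> is contractive.\<close>

lemma expansive_resolvent:
  assumes p: "\<And>n. contractive_multiplier N (p n)" and r: "\<And>n. 0 \<le> r n"
    and lim: "\<And>t. (\<lambda>n. 1 + r n * (1 - p n t)) \<longlonglongrightarrow> g t"
  shows "N Z \<le> N (schur g x y Z)"
proof -
  have "N Z \<le> N (schur (\<lambda>t. 1 + r n * (1 - p n t)) x y Z)" for n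
  proof -
    \<comment> \<open>The triangle inequality on this splitting costs at most
      \<open>r n * N Z\<close>, which leaves exactly \<open>N Z\<close> on the left.\<close>
    have "(1 + r n) *\<^sub>R Z = schur (\<lambda>t. 1 + r n * (1 - p n t)) x y Z + r n *\<^sub>R schur (p n) x y Z"
      by (simp add: schur_def vec_eq_iff scaleR_conv_of_real[where 'a=complex] algebra_simps)
    then have "N ((1 + r n) *\<^sub>R Z) \<le>
        N (schur (\<lambda>t. 1 + r n * (1 - p n t)) x y Z) + N (r n *\<^sub>R schur (p n) x y Z)"
      by (simp only: norm_triangle)
    moreover have "N (r n *\<^sub>R schur (p n) x y Z) \<le> r n * N Z"
      using p r by (simp add: norm_scaleR contractive_multiplier_def mult_left_mono)
    ultimately show ?thesis
      using r[of n] by (simp add: norm_scaleR distrib_right)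
  qed
  moreover have "(\<lambda>n. N (schur (\<lambda>t. 1 + r n * (1 - p n t)) x y Z)) \<longlonglongrightarrow> N (schur g x y Z)"
    by (intro tendsto_uinorm tendsto_schur lim)
  ultimately show ?thesis
    by (intro LIMSEQ_le_const[of _ "N (schur g x y Z)"]) auto
qed

text \<open>\<open>expansive_resolvent\<close> is applied to the already damped matrix, on which
  multiplication by \<open>1 + (c * t)\<^sup>2\<close> restores \<open>Z\<close>.\<close>

lemma contractive_resolvent: "contractive_multiplier N (\<lambda>t. 1 / (1 + (c * t)\<^sup>2))"
  unfolding contractive_multiplier_def
proof (intro allI)
  fix x y Z
  have "contractive_multiplier N (\<lambda>t. cos (t / real n))" for n
    using contractive_dilate[OF contractive_cos, of "1 / real n"] by simp
  moreover have "(\<lambda>n. 1 + (2 * c\<^sup>2 * (real n)\<^sup>2) * (1 - cos (t / real n))) \<longlonglongrightarrow> 1 + (c * t)\<^sup>2" for t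
    using cos_resolvent_limit[of c t] by (simp add: power_mult_distrib)
  ultimately have "N (schur (\<lambda>t. 1 / (1 + (c * t)\<^sup>2)) x y Z) \<le>
      N (schur (\<lambda>t. 1 + (c * t)\<^sup>2) x y (schur (\<lambda>t. 1 / (1 + (c * t)\<^sup>2)) x y Z))"
    by (intro expansive_resolvent[where p = "\<lambda>n t. cos (t / real n)" and r = "\<lambda>n. 2 * c\<^sup>2 * (real n)\<^sup>2"]) auto
  also have "schur (\<lambda>t. 1 + (c * t)\<^sup>2) x y (schur (\<lambda>t. 1 / (1 + (c * t)\<^sup>2)) x y Z) = Z"
  proof -
    have "1 + (c * t)\<^sup>2 \<noteq> 0" for t
      using zero_le_power2[of "c * t"] by linarith
    then show ?thesis
      by (simp add: schur_schur schur_const)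
  qed
  finally show "N (schur (\<lambda>t. 1 / (1 + (c * t)\<^sup>2)) x y Z) \<le> N Z" .
qed

lemma contractive_inverse_sinhc: "contractive_multiplier N (\<lambda>t. 1 / sinhc t)"
proof (rule contractive_limit)
  show "contractive_multiplier N (\<lambda>t. \<Prod>k=1..n. 1 / (1 + (1 / (pi * real k) * t)\<^sup>2))" for n
    by (intro contractive_prod contractive_resolvent)
  show "(\<lambda>n. \<Prod>k=1..n. 1 / (1 + (1 / (pi * real k) * t)\<^sup>2)) \<longlonglongrightarrow> 1 / sinhc t" for t
    using tendsto_divide[OF tendsto_const[of 1] sinhc_product[of t]] sinhc_pos[of t]
    by (simp add: prod_dividef)
qed

lemma contractive_sinhc_ratio:
  assumes "1 \<le> l"
  shows "contractive_multiplier N (\<lambda>t. sinhc t / sinhc (l * t))"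
proof (rule contractive_limit)
  let ?f = "\<lambda>k t. (1 + (t / (pi * real k))\<^sup>2) / (1 + (l * t / (pi * real k))\<^sup>2)"
  show "contractive_multiplier N (\<lambda>t. \<Prod>k=1..n. ?f k t)" for n
  proof (rule contractive_prod)
    fix k assume "k \<in> {1..n}"
    \<comment> \<open>The weights are \<open>1 / l\<^sup>2\<close> and
      \<open>1 - 1 / l\<^sup>2\<close>; the second is nonnegative because
      \<open>l \<ge> 1\<close>.\<close>
    have "?f k = (\<lambda>t. 1 / l\<^sup>2 * 1 + (1 - 1 / l\<^sup>2) * (1 / (1 + (l / (pi * real k) * t)\<^sup>2)))"
    proof
      fix t
      define s where "s = (t / (pi * real k))\<^sup>2"
      have "1 + l\<^sup>2 * s > 0"
        by (intro add_pos_nonneg) (auto simp: s_def)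
      then have "(1 + s) / (1 + l\<^sup>2 * s) = 1 / l\<^sup>2 * 1 + (1 - 1 / l\<^sup>2) * (1 / (1 + l\<^sup>2 * s))"
        using assms by (simp add: divide_simps) (simp add: algebra_simps)
      then show "?f k t = 1 / l\<^sup>2 * 1 + (1 - 1 / l\<^sup>2) * (1 / (1 + (l / (pi * real k) * t)\<^sup>2))"
        by (simp add: s_def power_mult_distrib power_divide)
    qed
    moreover have "contractive_multiplier N
        (\<lambda>t. 1 / l\<^sup>2 * 1 + (1 - 1 / l\<^sup>2) * (1 / (1 + (l / (pi * real k) * t)\<^sup>2)))"
      using assms by (intro contractive_convex contractive_const1 contractive_resolvent) simp_all
    ultimately show "contractive_multiplier N (?f k)" by simp
  qed
  show "(\<lambda>n. \<Prod>k=1..n. ?f k t) \<longlonglongrightarrow> sinhc t / sinhc (l * t)" for t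
    using tendsto_divide[OF sinhc_product[of t] sinhc_product[of "l * t"]] sinhc_pos[of "l * t"]
    by (simp add: prod_dividef)
qed

text \<open>Contractivity of \<open>1 / sinhc\<close> read backwards; this is the first inequality
  of the theorem once \<open>Z\<close> carries the midpoint multiplier.\<close>

lemma norm_le_sinhc: "N Z \<le> N (schur (\<lambda>t. sinhc (c * t)) x y Z)"
proof -
  have "N (schur (\<lambda>t. 1 / sinhc (c * t)) x y (schur (\<lambda>t. sinhc (c * t)) x y Z))
      \<le> N (schur (\<lambda>t. sinhc (c * t)) x y Z)"
    using contractive_dilate[OF contractive_inverse_sinhc, of c]
    by (simp add: contractive_multiplier_def)
  moreover have "sinhc t \<noteq> 0" for t
    using sinhc_pos[of t] by simp
  ultimately show ?thesis
    by (simp add: schur_schur schur_const)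
qed

text \<open>The second inequality: passing from \<open>sinhc\<close> to \<open>cosh\<close>
  multiplies by \<open>cosh t / sinhc t\<close>, which is expansive by
  \<open>sinhc_ratio_limit\<close> and \<open>expansive_resolvent\<close>.\<close>

lemma sinhc_le_cosh:
  "N (schur (\<lambda>t. sinhc (c * t)) x y Z) \<le> N (schur (\<lambda>t. cosh (c * t)) x y Z)"
proof -
  \<comment> \<open>At \<open>n = 0\<close> the convention \<open>1 / 0 = 0\<close> gives
    \<open>l = 1\<close>, so the bound on \<open>l\<close> holds for every \<open>n\<close>.\<close>
  have "contractive_multiplier N (\<lambda>t. sinhc t / sinhc ((1 + 1 / real n) * t))" for n
    by (rule contractive_sinhc_ratio) simp
  then have "N W \<le> N (schur (\<lambda>t. cosh t / sinhc t) x y W)" for x y W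
    using sinhc_ratio_limit
    by (intro expansive_resolvent[where r = real
          and p = "\<lambda>n t. sinhc t / sinhc ((1 + 1 / real n) * t)"]) auto
  \<comment> \<open>The dilation by \<open>c\<close> is absorbed into the nodes.\<close>
  from this[of "schur (\<lambda>t. sinhc (c * t)) x y Z" "\<lambda>i. c * x i" "\<lambda>j. c * y j"]
  have "N (schur (\<lambda>t. sinhc (c * t)) x y Z)
      \<le> N (schur (\<lambda>t. cosh (c * t) / sinhc (c * t)) x y (schur (\<lambda>t. sinhc (c * t)) x y Z))"
    by (simp only: schur_dilate[of "\<lambda>t. cosh t / sinhc t"])
  moreover have "sinhc t \<noteq> 0" for t
    using sinhc_pos[of t] by simp
  ultimately show ?thesis
    by (simp add: schur_schur)
qed

end

section \<open>Spectral theorem\<close>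

text \<open>A maximizer \<open>v\<close> of the Rayleigh quotient on the unit sphere of
  \<open>S\<close> is an eigenvector: the form of \<open>g = c - f\<close> is nonnegative on
  \<open>S\<close> and vanishes at \<open>v\<close>, which forces \<open>g v = 0\<close>.\<close>

lemma selfadjoint_eigenvector:
  fixes f :: "'a::euclidean_space \<Rightarrow> 'a"
  assumes lin: "linear f" and adj: "\<And>x y. x \<bullet> f y = f x \<bullet> y"
    and S: "subspace S" "f ` S \<subseteq> S" "S \<noteq> {0}"
  obtains v c where "v \<in> S" "norm v = 1" "f v = c *\<^sub>R v"
proof -
  interpret linear f by (rule lin)
  let ?K = "S \<inter> sphere 0 1"
  obtain w where w: "w \<in> S" "w \<noteq> 0"
    using S subspace_0 by blast
  then have "(1 / norm w) *\<^sub>R w \<in> ?K"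
    by (auto intro: subspace_mul S)
  moreover have "compact ?K"
    by (intro closed_Int_compact closed_subspace S compact_sphere)
  moreover have "continuous_on ?K (\<lambda>x. x \<bullet> f x)"
    by (intro continuous_intros linear_continuous_on linear_linear[THEN iffD2] lin)
  ultimately obtain v where v: "v \<in> ?K" and max: "\<And>x. x \<in> ?K \<Longrightarrow> x \<bullet> f x \<le> v \<bullet> f v"
    using continuous_attains_sup[of ?K "\<lambda>x. x \<bullet> f x"] by blast
  define c where "c = v \<bullet> f v"
  define g where "g x = c *\<^sub>R x - f x" for x
  have g_sym: "x \<bullet> g y = g x \<bullet> y" for x y
    by (simp add: g_def inner_diff_left inner_diff_right adj)
  have nonneg: "0 \<le> x \<bullet> g x" if "x \<in> S" for x
  proof (cases "x = 0")
    case False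
    have "(1 / norm x) *\<^sub>R x \<in> ?K"
      using False that by (auto intro: subspace_mul S)
    from max[OF this] have "x \<bullet> f x \<le> c * (x \<bullet> x)"
      using False by (simp add: c_def scale field_simps power2_norm_eq_inner[symmetric] power2_eq_square)
    then show ?thesis
      by (simp add: g_def inner_diff_right)
  qed simp
  have gv: "v \<bullet> g v = 0"
    using v by (simp add: g_def inner_diff_right c_def norm_eq_1)
  have gvS: "g v \<in> S"
    using v S unfolding g_def by (intro subspace_diff subspace_mul S) auto
  define a where "a = g v \<bullet> g v"
  define b where "b = g v \<bullet> g (g v)"
  \<comment> \<open>Perturbing \<open>v\<close> in the direction \<open>g v\<close> exposes the
    linear term \<open>2 * t * a\<close>, which must vanish.\<close>
  have quad: "0 \<le> 2 * t * a + t\<^sup>2 * b" for t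
  proof -
    have "0 \<le> (v + t *\<^sub>R g v) \<bullet> g (v + t *\<^sub>R g v)"
      using v gvS by (intro nonneg subspace_add subspace_mul S) auto
    also have "g (v + t *\<^sub>R g v) = g v + t *\<^sub>R g (g v)"
      by (simp add: g_def add scale diff algebra_simps)
    also have "(v + t *\<^sub>R g v) \<bullet> (g v + t *\<^sub>R g (g v)) = t * (v \<bullet> g (g v)) + t * a + t\<^sup>2 * b"
      by (simp add: gv a_def b_def inner_add_left inner_add_right algebra_simps power2_eq_square)
    also have "v \<bullet> g (g v) = a"
      unfolding a_def by (simp add: g_sym)
    finally show ?thesis by (simp add: algebra_simps)
  qed
  have "a = 0"
  proof (rule ccontr)
    assume "a \<noteq> 0"
    then have a: "a > 0" by (simp add: a_def)
    have b: "b \<ge> 0" unfolding b_def by (rule nonneg[OF gvS])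
    \<comment> \<open>A step short enough for the linear term to dominate at \<open>t = - s\<close>;
      the added \<open>1\<close> covers \<open>b = 0\<close>.\<close>
    define s where "s = a / (b + 1)"
    have "s > 0" using a b by (simp add: s_def)
    moreover have "s * (b + 1) = a" using b by (simp add: s_def)
    then have "s * b = a - s" by (simp add: distrib_left)
    ultimately have "s * (s * b - 2 * a) < 0"
      using a by (intro mult_pos_neg) auto
    moreover have "s * (s * b - 2 * a) = 2 * (- s) * a + (- s)\<^sup>2 * b"
      by (simp add: algebra_simps power2_eq_square)
    ultimately show False using quad[of "- s"] by linarith
  qed
  then have "f v = c *\<^sub>R v" by (simp add: a_def g_def)
  with v that show thesis by auto
qed

section \<open>The complex inner product and its real part\<close>

lemma Re_cinner: "Re (cinner x y) = x \<bullet> y"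
  by (simp add: cinner_def inner_vec_def inner_complex_def)

lemma cinner_self: "cinner x x = of_real ((norm x)\<^sup>2)"
proof -
  have "Im (cinner x x) = 0"
    by (simp add: cinner_def mult.commute)
  then show ?thesis
    by (simp add: complex_eq_iff Re_cinner power2_norm_eq_inner)
qed

lemma cinner_commute: "cnj (cinner x y) = cinner y x"
  by (simp add: cinner_def mult.commute)

lemma cinner_add_right: "cinner x (y + z) = cinner x y + cinner x z"
  by (simp add: cinner_def algebra_simps sum.distrib)

lemma cinner_scaleR_right: "cinner x (c *\<^sub>R y) = of_real c * cinner x y"
  by (simp add: cinner_def sum_distrib_left scaleR_conv_of_real[symmetric])

lemma cinner_scale_left: "cinner (c *s x) y = cnj c * cinner x y"
  by (simp add: cinner_def sum_distrib_left mult.assoc)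

lemma cinner_matrix: "cinner x (A *v y) = cinner (cadjoint A *v x) y"
  unfolding cinner_def matrix_vector_mult_def cadjoint_def
  by (simp add: sum_distrib_left sum_distrib_right mult_ac) (subst sum.swap, rule refl)

text \<open>Induction on the index set: the orthogonal complement of the eigenvectors found so far
  is invariant under \<open>A\<close>, so it contains a further one.\<close>

lemma hermitian_orthonormal_eigenvectors:
  fixes A :: "complex^'n^'n"
  assumes herm: "cadjoint A = A" and "finite (I :: 'n set)"
  shows "\<exists>(e :: 'n \<Rightarrow> complex^'n) d. (\<forall>i\<in>I. A *v e i = d i *\<^sub>R e i) \<and>
           (\<forall>i\<in>I. \<forall>j\<in>I. cinner (e i) (e j) = (if i = j then 1 else 0))"
  using \<open>finite I\<close>
proof (induction I rule: finite_induct)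
  case (insert k I)
  then obtain e :: "'n \<Rightarrow> complex^'n" and d where
    eig: "\<And>i. i \<in> I \<Longrightarrow> A *v e i = d i *\<^sub>R e i"
    and orth: "\<And>i j. i \<in> I \<Longrightarrow> j \<in> I \<Longrightarrow> cinner (e i) (e j) = (if i = j then 1 else 0)"
    by metis
  define S where "S = {v. \<forall>i\<in>I. cinner (e i) v = 0}"
  \<comment> \<open>Adjoining the multiples by \<open>\<i>\<close> makes real orthogonality to
    \<open>?T\<close> amount to complex orthogonality to all \<open>e i\<close>. The real dimension
    is at most \<open>2 * card I\<close>, below \<open>2 * CARD('n)\<close>.\<close>
  let ?T = "e ` I \<union> (\<lambda>i. \<i> *s e i) ` I"
  have "card I < CARD('n)"
    using insert.hyps by (metis UNIV_I finite psubset_card_mono psubsetI subset_UNIV)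
  moreover have "card ?T \<le> card I + card I"
    using insert.hyps by (intro order.trans[OF card_Un_le] add_mono card_image_le)
  moreover have "dim ?T \<le> card ?T"
    using insert.hyps by (intro dim_le_card') auto
  ultimately have "dim ?T < DIM(complex^'n)"
    by simp
  then obtain x where x: "x \<noteq> 0" "\<And>y. y \<in> span ?T \<Longrightarrow> orthogonal x y"
    using orthogonal_to_subspace_exists by blast
  have "cinner (e i) x = 0" if "i \<in> I" for i
  proof -
    have "Re (cinner (e i) x) = 0" "Re (cinner (\<i> *s e i) x) = 0"
      using that x(2)[of "e i"] x(2)[of "\<i> *s e i"]
      by (auto simp: Re_cinner orthogonal_def inner_commute span_base)
    then show ?thesis by (simp add: cinner_scale_left complex_eq_iff)
  qed
  then have "x \<in> S" by (simp add: S_def)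
  have sub: "subspace S"
    unfolding S_def by (auto simp: subspace_def cinner_add_right cinner_scaleR_right)
      (simp add: cinner_def)
  have lin: "linear ((*v) A)"
    by (intro linearI) (simp_all add: matrix_vector_mult_def vec_eq_iff algebra_simps sum.distrib
        scaleR_sum_right)
  have "x \<bullet> (A *v y) = (A *v x) \<bullet> y" for x y
    by (simp add: Re_cinner[symmetric] cinner_matrix herm)
  moreover have "(*v) A ` S \<subseteq> S"
  proof clarify
    fix v assume v: "v \<in> S"
    have "cinner (e i) (A *v v) = 0" if "i \<in> I" for i
    proof -
      have "cinner (e i) (A *v v) = cnj (cinner v (d i *\<^sub>R e i))"
        using that by (simp add: cinner_matrix herm eig cinner_commute)
      also have "\<dots> = of_real (d i) * cinner (e i) v"
        by (simp add: cinner_scaleR_right cinner_commute)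
      finally show ?thesis using v that by (simp add: S_def)
    qed
    then show "A *v v \<in> S" by (simp add: S_def)
  qed
  moreover have "S \<noteq> {0}" using \<open>x \<in> S\<close> x by auto
  ultimately obtain v c where v: "v \<in> S" "norm v = 1" "A *v v = c *\<^sub>R v"
    using selfadjoint_eigenvector[OF lin _ sub] by blast
  have v0: "cinner (e i) v = 0" "cinner v (e i) = 0" if "i \<in> I" for i
    using v(1) that cinner_commute[of "e i" v] by (auto simp: S_def)
  have vv: "cinner v v = 1" by (simp add: cinner_self v(2))
  show ?case
  proof (intro exI conjI ballI)
    fix i assume "i \<in> insert k I"
    then show "A *v (e(k := v)) i = (d(k := c)) i *\<^sub>R (e(k := v)) i"
      using eig v(3) by auto
    fix j assume "j \<in> insert k I"
    then show "cinner ((e(k := v)) i) ((e(k := v)) j) = (if i = j then 1 else 0)"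
      using \<open>i \<in> insert k I\<close> insert.hyps orth v0 vv by auto
  qed
qed auto

text \<open>Supplies the hypotheses of \<open>mpowr_eqI\<close>. The columns of \<open>U\<close> are
  orthonormal eigenvectors, and positivity of \<open>d\<close> comes from the quadratic form at each
  of them.\<close>

lemma pos_def_diagonalization:
  fixes A :: "complex^'n^'n"
  assumes "pos_def A"
  obtains U d where "unitary U" "\<And>i. 0 < d i" "A = U ** diag_of d ** cadjoint U"
proof -
  have herm: "cadjoint A = A" using assms by (simp add: pos_def_def)
  obtain e :: "'n \<Rightarrow> complex^'n" and d where
    eig: "\<And>i. A *v e i = d i *\<^sub>R e i"
    and orth: "\<And>i j. cinner (e i) (e j) = (if i = j then 1 else 0)"
    using hermitian_orthonormal_eigenvectors[OF herm, of UNIV] by auto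
  define U :: "complex^'n^'n" where "U = (\<chi> i j. e j $ i)"
  have UU: "cadjoint U ** U = mat 1"
    using orth by (simp add: U_def cadjoint_def matrix_matrix_mult_def mat_def vec_eq_iff cinner_def)
  then have UU': "U ** cadjoint U = mat 1"
    by (simp add: matrix_left_right_inverse)
  have "(A ** U) $ i $ j = (U ** diag_of d) $ i $ j" for i j
  proof -
    have "(A ** U) $ i $ j = (A *v e j) $ i"
      by (simp add: matrix_matrix_mult_def matrix_vector_mult_def U_def)
    also have "\<dots> = (U ** diag_of d) $ i $ j"
      by (simp only: mult_diag_of_nth) (simp add: eig U_def scaleR_conv_of_real[where 'a=complex] mult.commute)
    finally show ?thesis .
  qed
  then have "A ** U = U ** diag_of d" by (simp add: vec_eq_iff)
  then have "A ** U ** cadjoint U = U ** diag_of d ** cadjoint U" by simp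
  then have "A = U ** diag_of d ** cadjoint U"
    by (simp add: matrix_mul_assoc[symmetric] UU')
  moreover have "0 < d i" for i
  proof -
    have "e i \<noteq> 0" using orth[of i i] by (auto simp: cinner_def)
    then have "0 < Re (cinner (e i) (A *v e i))"
      using assms by (simp add: pos_def_def)
    then show ?thesis by (simp add: eig cinner_scaleR_right orth)
  qed
  ultimately show thesis
    using UU UU' that by (auto simp: unitary_def)
qed

section \<open>Heinz means\<close>

lemma unitary_cadjoint: "unitary U \<Longrightarrow> unitary (cadjoint U)"
  by (simp add: unitary_def cadjoint_def)

lemma linear_matrix_sandwich: "linear (\<lambda>K. U ** K ** V :: complex^'n^'n)"
  for U V :: "complex^'n^'n"
proof (intro linearI)
  have "(P + Q) ** V = P ** V + Q ** V" for P Q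
    by (vector matrix_matrix_mult_def sum.distrib[symmetric] distrib_right)
  then show "U ** (S + T) ** V = U ** S ** V + U ** T ** V" for S T
    by (simp add: matrix_add_ldistrib)
  show "U ** (c *\<^sub>R T) ** V = c *\<^sub>R (U ** T ** V)" for c T
    by (simp add: matrix_scalar_ac scalar_matrix_assoc)
qed

text \<open>In the eigenbases of \<open>A\<close> and \<open>B\<close> the powers act entrywise.
  \<open>Z\<close> absorbs the factor free of \<open>\<nu>\<close>, so one choice of
  \<open>U\<close>, \<open>V\<close>, \<open>x\<close>, \<open>y\<close>, \<open>Z\<close> serves
  every \<open>\<nu>\<close>.\<close>

lemma heinz_mean_schur:
  fixes A B X :: "complex^'n^'n"
  assumes "pos_def A" "pos_def B"
  obtains U V x y Z where "unitary U" "unitary V"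
    "\<And>\<nu>. mpowr A \<nu> ** X ** mpowr B (1 - \<nu>) + mpowr A (1 - \<nu>) ** X ** mpowr B \<nu>
       = U ** schur (\<lambda>t. cosh ((\<nu> - 1 / 2) * t)) x y Z ** V"
proof -
  obtain U a where U: "unitary U" "\<And>i. 0 < a i" "A = U ** diag_of a ** cadjoint U"
    using pos_def_diagonalization[OF assms(1)] by blast
  obtain V b where V: "unitary V" "\<And>i. 0 < b i" "B = V ** diag_of b ** cadjoint V"
    using pos_def_diagonalization[OF assms(2)] by blast
  define x where "x i = ln (a i)" for i
  define y where "y j = ln (b j)" for j
  define Y where "Y = cadjoint U ** X ** V"
  define Z where "Z = (\<chi> i j. of_real (2 * exp ((x i + y j) / 2)) * Y $ i $ j)"
  have powr: "a i powr r = exp (r * x i)" "b i powr r = exp (r * y i)" for i r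
    using U(2)[of i] V(2)[of i] by (auto simp: powr_def x_def y_def)
  have "mpowr A \<nu> ** X ** mpowr B (1 - \<nu>) + mpowr A (1 - \<nu>) ** X ** mpowr B \<nu>
       = U ** schur (\<lambda>t. cosh ((\<nu> - 1 / 2) * t)) x y Z ** cadjoint V" for \<nu>
  proof -
    have "mpowr A \<nu> ** X ** mpowr B (1 - \<nu>) + mpowr A (1 - \<nu>) ** X ** mpowr B \<nu>
      = U ** (diag_of (\<lambda>i. a i powr \<nu>) ** Y ** diag_of (\<lambda>i. b i powr (1 - \<nu>))
          + diag_of (\<lambda>i. a i powr (1 - \<nu>)) ** Y ** diag_of (\<lambda>i. b i powr \<nu>)) ** cadjoint V"
      by (simp add: mpowr_eqI[OF U] mpowr_eqI[OF V] Y_def matrix_mul_assoc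
          linear_add[OF linear_matrix_sandwich])
    also have "diag_of (\<lambda>i. a i powr \<nu>) ** Y ** diag_of (\<lambda>i. b i powr (1 - \<nu>))
          + diag_of (\<lambda>i. a i powr (1 - \<nu>)) ** Y ** diag_of (\<lambda>i. b i powr \<nu>)
        = schur (\<lambda>t. cosh ((\<nu> - 1 / 2) * t)) x y Z"
    proof -
      have "of_real (a i powr \<nu>) * Y $ i $ j * of_real (b j powr (1 - \<nu>))
          + of_real (a i powr (1 - \<nu>)) * Y $ i $ j * of_real (b j powr \<nu>)
          = of_real (cosh ((\<nu> - 1 / 2) * (x i - y j))) *
            (of_real (2 * exp ((x i + y j) / 2)) * Y $ i $ j)" for i j
      proof -
        have "of_real (a i powr \<nu>) * Y $ i $ j * of_real (b j powr (1 - \<nu>))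
          + of_real (a i powr (1 - \<nu>)) * Y $ i $ j * of_real (b j powr \<nu>)
          = of_real (a i powr \<nu> * b j powr (1 - \<nu>) + a i powr (1 - \<nu>) * b j powr \<nu>) * Y $ i $ j"
          by (simp add: algebra_simps)
        also have "\<dots> = of_real (cosh ((\<nu> - 1 / 2) * (x i - y j)) * (2 * exp ((x i + y j) / 2))) * Y $ i $ j"
          by (simp only: powr heinz_mean_eq_cosh)
        finally show ?thesis by (simp add: mult.assoc)
      qed
      then show ?thesis
        by (simp add: vec_eq_iff diag_of_mult_nth mult_diag_of_nth schur_def Z_def)
    qed
    finally show ?thesis .
  qed
  with U(1) V(1) show thesis
    using that unitary_cadjoint by blast
qed

text \<open>Fundamental theorem of calculus, with the antiderivative taken inside the linear map
  \<open>L\<close>. The integral is oriented, so the order of \<open>\<alpha>\<close> and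
  \<open>\<beta>\<close> is arbitrary.\<close>

lemma integral_heinz_schur:
  fixes U V Z :: "complex^'n^'n"
  shows "(LBINT \<nu>=ereal \<alpha>..ereal \<beta>. U ** schur (\<lambda>t. cosh ((\<nu> - 1 / 2) * t)) x y Z ** V)
    = (\<beta> - \<alpha>) *\<^sub>R (U ** schur (\<lambda>t. sinhc ((\<beta> - \<alpha>) / 2 * t)) x y
        (schur (\<lambda>t. cosh (((\<alpha> + \<beta>) / 2 - 1 / 2) * t)) x y Z) ** V)"
proof -
  define L where "L K = U ** K ** V" for K :: "complex^'n^'n"
  have lin: "linear L"
    using linear_matrix_sandwich unfolding L_def .
  then have bl: "bounded_linear L" by (simp add: linear_conv_bounded_linear)
  have deriv: "((\<lambda>\<nu>. L (schur (\<lambda>t. (\<nu> - 1 / 2) * sinhc ((\<nu> - 1 / 2) * t)) x y Z))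
      has_vector_derivative L (schur (\<lambda>t. cosh ((\<nu> - 1 / 2) * t)) x y Z)) (at \<nu> within S)" for \<nu> S
    by (intro bounded_linear.has_vector_derivative[OF bl] has_vector_derivative_schur
        real_derivative_mult_sinhc)
  \<comment> \<open>Differentiating the integrand yields the continuity that the fundamental theorem
    asks for.\<close>
  have "((\<lambda>\<nu>. L (schur (\<lambda>t. cosh ((\<nu> - 1 / 2) * t)) x y Z))
      has_vector_derivative L (schur (\<lambda>t. t * sinh ((\<nu> - 1 / 2) * t)) x y Z)) (at \<nu> within S)" for \<nu> S
    by (intro bounded_linear.has_vector_derivative[OF bl] has_vector_derivative_schur)
       (auto intro!: derivative_eq_intros)
  then have cont: "continuous_on S (\<lambda>\<nu>. L (schur (\<lambda>t. cosh ((\<nu> - 1 / 2) * t)) x y Z))" for S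
    by (rule continuous_on_vector_derivative)
  have "(LBINT \<nu>=ereal \<alpha>..ereal \<beta>. L (schur (\<lambda>t. cosh ((\<nu> - 1 / 2) * t)) x y Z))
      = L (schur (\<lambda>t. (\<beta> - 1 / 2) * sinhc ((\<beta> - 1 / 2) * t)) x y Z)
        - L (schur (\<lambda>t. (\<alpha> - 1 / 2) * sinhc ((\<alpha> - 1 / 2) * t)) x y Z)"
    by (rule interval_integral_FTC_finite[OF cont deriv])
  also have "\<dots> = L (schur (\<lambda>t. (\<beta> - 1 / 2) * sinhc ((\<beta> - 1 / 2) * t)
        - (\<alpha> - 1 / 2) * sinhc ((\<alpha> - 1 / 2) * t)) x y Z)"
    unfolding linear_diff[OF lin, symmetric]
    by (rule arg_cong[of _ _ L]) (simp add: schur_def vec_eq_iff left_diff_distrib)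
  also have "\<dots> = L ((\<beta> - \<alpha>) *\<^sub>R schur (\<lambda>t. sinhc ((\<beta> - \<alpha>) / 2 * t)) x y
        (schur (\<lambda>t. cosh (((\<alpha> + \<beta>) / 2 - 1 / 2) * t)) x y Z))"
    unfolding mult_sinhc_diff schur_cmult schur_schur
    by (simp add: add_divide_distrib diff_divide_distrib add.commute)
  finally show ?thesis
    by (simp add: linear_scale[OF lin]) (simp add: L_def)
qed

theorem theorem4p1:
  fixes A B X :: "complex^'n^'n"
    and \<alpha> \<beta> :: real
    and N :: "complex^'n^'n \<Rightarrow> real"
  assumes "pos_def A" and "pos_def B"
    and "\<alpha> \<noteq> \<beta>"
    and "unitarily_invariant_norm N"
  shows "N (mpowr A ((\<alpha> + \<beta>) / 2) ** X ** mpowr B (1 - (\<alpha> + \<beta>) / 2)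
            + mpowr A (1 - (\<alpha> + \<beta>) / 2) ** X ** mpowr B ((\<alpha> + \<beta>) / 2))
         \<le> 1 / \<bar>\<beta> - \<alpha>\<bar> *
            N (LBINT \<nu>=ereal \<alpha>..ereal \<beta>.
                 (mpowr A \<nu> ** X ** mpowr B (1 - \<nu>) + mpowr A (1 - \<nu>) ** X ** mpowr B \<nu>))
       \<and> 1 / \<bar>\<beta> - \<alpha>\<bar> *
            N (LBINT \<nu>=ereal \<alpha>..ereal \<beta>.
                 (mpowr A \<nu> ** X ** mpowr B (1 - \<nu>) + mpowr A (1 - \<nu>) ** X ** mpowr B \<nu>))
         \<le> 1 / 2 *
            N (mpowr A \<alpha> ** X ** mpowr B (1 - \<alpha>) + mpowr A (1 - \<alpha>) ** X ** mpowr B \<alpha>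
               + mpowr A \<beta> ** X ** mpowr B (1 - \<beta>) + mpowr A (1 - \<beta>) ** X ** mpowr B \<beta>)"
proof -
  note N = assms(4)
  obtain U V x y Z where UV: "unitary U" "unitary V"
    and mean: "\<And>\<nu>. mpowr A \<nu> ** X ** mpowr B (1 - \<nu>) + mpowr A (1 - \<nu>) ** X ** mpowr B \<nu>
       = U ** schur (\<lambda>t. cosh ((\<nu> - 1 / 2) * t)) x y Z ** V"
    using heinz_mean_schur[OF assms(1,2)] by metis
  define c where "c = (\<beta> - \<alpha>) / 2"
  \<comment> \<open>The midpoint multiplier is common to all three expressions; relative to
    \<open>W\<close> they carry \<open>1\<close>, \<open>sinhc (c * t)\<close> and
    \<open>cosh (c * t)\<close>.\<close>
  define W where "W = schur (\<lambda>t. cosh (((\<alpha> + \<beta>) / 2 - 1 / 2) * t)) x y Z"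
  have integral: "1 / \<bar>\<beta> - \<alpha>\<bar> * N (LBINT \<nu>=ereal \<alpha>..ereal \<beta>.
      (mpowr A \<nu> ** X ** mpowr B (1 - \<nu>) + mpowr A (1 - \<nu>) ** X ** mpowr B \<nu>))
      = N (schur (\<lambda>t. sinhc (c * t)) x y W)"
    unfolding mean integral_heinz_schur
    using assms(3) by (simp add: norm_scaleR[OF N] norm_unitary[OF N UV] c_def W_def)
  \<comment> \<open>The \<open>\<beta>\<close> term comes first so that the half difference in
    \<open>cosh_add_cosh\<close> is \<open>c\<close>.\<close>
  have "schur (\<lambda>t. cosh ((\<beta> - 1 / 2) * t)) x y Z + schur (\<lambda>t. cosh ((\<alpha> - 1 / 2) * t)) x y Z
      = 2 *\<^sub>R schur (\<lambda>t. cosh (c * t)) x y W"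
    unfolding schur_add[symmetric] cosh_add_cosh W_def schur_schur schur_cmult c_def
    by (simp add: add_divide_distrib diff_divide_distrib add.commute)
  then have "U ** schur (\<lambda>t. cosh ((\<alpha> - 1 / 2) * t)) x y Z ** V
      + U ** schur (\<lambda>t. cosh ((\<beta> - 1 / 2) * t)) x y Z ** V
      = U ** (2 *\<^sub>R schur (\<lambda>t. cosh (c * t)) x y W) ** V"
    by (simp add: linear_add[OF linear_matrix_sandwich, symmetric] add.commute)
  then have endpoints: "N (mpowr A \<alpha> ** X ** mpowr B (1 - \<alpha>) + mpowr A (1 - \<alpha>) ** X ** mpowr B \<alpha>
      + (mpowr A \<beta> ** X ** mpowr B (1 - \<beta>) + mpowr A (1 - \<beta>) ** X ** mpowr B \<beta>))
      = 2 * N (schur (\<lambda>t. cosh (c * t)) x y W)"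
    unfolding mean by (simp only: norm_unitary[OF N UV] norm_scaleR[OF N] abs_numeral)
  have midpoint: "N (mpowr A ((\<alpha> + \<beta>) / 2) ** X ** mpowr B (1 - (\<alpha> + \<beta>) / 2)
      + mpowr A (1 - (\<alpha> + \<beta>) / 2) ** X ** mpowr B ((\<alpha> + \<beta>) / 2)) = N W"
    unfolding mean W_def by (rule norm_unitary[OF N UV])
  show ?thesis
    unfolding integral midpoint
    using norm_le_sinhc[OF N, of W c x y] sinhc_le_cosh[OF N, of c x y W] endpoints
    by (simp add: add.assoc)
qed

end
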